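(* Let $a,M\in\mathbb{R}$. (i) If $a<M$, then, as $(\mu,\sigma)$ ranges over all pairs in $\mathbb{R}\times(0,\infty)$ for which the Gaussian function $f(x;\mu,\sigma)=f_{\max}e^{-(x-\mu)^2/(2\sigma^2)}$ (with $f_{\max}>0$) has mean $M$ over $[a,\infty)$, the supremum of the variances of $f(\cdot;\mu,\sigma)$ over $[a,\infty)$ is $$\sup \mathrm{Var}(x)_{|x\ge a}=(M-a)^2 .$$ (ii) If $a>M$, then, as $(\mu,\sigma)$ ranges over all pairs in $\mathbb{R}\times(0,\infty)$ for which $f(\cdot;\mu,\sigma)$ has mean $M$ over $(-\infty,a]$, the supremum of the variances of $f(\cdot;\mu,\sigma)$ over $(-\infty,a]$ is $$\sup \mathrm{Var}(x)_{|x\le a}=(M-a)^2 .$$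
   Context: For an interval $I=[a,\infty)$ or $I=(-\infty,a]$, the mean and variance of $f$ over $I$ are those of the truncated Gaussian distribution, i.e. of the probability density $f(x)\big/\int_I f(t)\,dt$ on $I$: the mean is $\int_I x f(x)\,dx\big/\int_I f(x)\,dx$ and, if this mean is $M$, the variance is $\int_I (x-M)^2 f(x)\,dx\big/\int_I f(x)\,dx$ (neither depends on $f_{\max}$). These are denoted with the subscript $|x\ge a$ when $I=[a,\infty)$ and $|x\le a$ when $I=(-\infty,a]$. *)

theory Defs
  imports "HOL-Analysis.Analysis"
begin

definition gaussian :: "real \<Rightarrow> real \<Rightarrow> real \<Rightarrow> real \<Rightarrow> real" where
  "gaussian fmax \<mu> \<sigma> x = fmax * exp (- ((x - \<mu>)\<^sup>2) / (2 * \<sigma>\<^sup>2))"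

definition mean_over :: "real set \<Rightarrow> (real \<Rightarrow> real) \<Rightarrow> real" where
  "mean_over I f = (LINT x:I|lborel. x * f x) / (LINT x:I|lborel. f x)"

definition variance_over :: "real set \<Rightarrow> (real \<Rightarrow> real) \<Rightarrow> real" where
  "variance_over I f =
     (LINT x:I|lborel. (x - mean_over I f)\<^sup>2 * f x) / (LINT x:I|lborel. f x)"

end

theory Submission
  imports Defs "HOL-Probability.Distributions"
begin

text \<open>
  The number \<^term>\<open>(M - a)\<^sup>2\<close> is the variance of the exponential distribution on
  \<^term>\<open>{a..}\<close> with mean \<open>M\<close>. That distribution is a limit of truncated Gaussians, and no
  truncated Gaussian with the same mean exceeds its variance, because the logarithm of a Gaussian is
  strictly concave.

  Upper bound (\<open>gaussian_tail_second_moment_le\<close>). Let \<open>f\<close> be a Gaussian on \<^term>\<open>{a..}\<close> and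
  let \<open>q\<close> be the multiple of an exponential density with the same mass and the same mean. Then
  \<open>Q = ln f - ln q\<close> is a quadratic polynomial with negative leading coefficient \<open>- A\<close>, and
  \<open>Q * (f - q)\<close> is nowhere negative because \<open>ln\<close> is increasing. As \<open>f - q\<close> integrates to zero
  against constant and linear functions, the integral of \<open>Q * (f - q)\<close> is \<open>- A\<close> times that of
  \<open>(x - a)\<^sup>2 * (f - q)\<close>. So the second moment of \<open>f\<close> about \<open>a\<close> is at most that of \<open>q\<close>.
  Integrated, the pointwise inequality says that a symmetrised relative entropy is nonnegative.

  Sharpness (\<open>gaussian_tail_variance_approaches\<close>). On \<^term>\<open>{0..}\<close> the Gaussian proportional to
  \<open>exp (- y - \<epsilon> * y\<^sup>2)\<close> has moments within \<open>O(\<epsilon>)\<close> of those of \<open>exp (- y)\<close>, by the bound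
  \<open>1 - t \<le> exp (- t)\<close>. Gaussians form a family closed under affine maps, so a dilation of this
  one has mean exactly \<open>M\<close>; no equation for the mean has to be solved. The ratio
  of the variance to \<^term>\<open>(M - a)\<^sup>2\<close> is invariant under the dilation and tends to 1 as \<open>\<epsilon>\<close>
  tends to 0.

  The left tail follows by the reflection \<open>x \<mapsto> - x\<close>.
\<close>

section \<open>Moments on a half-line about its end point\<close>

text \<open>Moments about the end point scale by a power of the ratio under dilations of the half-line,
  so they are more convenient here than moments about zero or about the mean.\<close>
definition tail_moment :: "real \<Rightarrow> nat \<Rightarrow> (real \<Rightarrow> real) \<Rightarrow> real" where
  "tail_moment a k f = (LINT x:{a..}|lborel. (x - a) ^ k * f x)"

lemma tail_moment_affine:
  fixes c :: real
  assumes "c > 0"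
  shows "tail_moment a k f = c ^ (k + 1) * tail_moment 0 k (\<lambda>y. f (a + c * y))"
proof -
  have "tail_moment a k f =
      \<bar>c\<bar> *\<^sub>R (\<integral>y. indicator {a..} (a + c * y) *\<^sub>R ((a + c * y - a) ^ k * f (a + c * y)) \<partial>lborel)"
    unfolding tail_moment_def set_lebesgue_integral_def
    by (rule lborel_integral_real_affine) (use assms in simp)
  also have "(\<lambda>y. indicator {a..} (a + c * y) *\<^sub>R ((a + c * y - a) ^ k * f (a + c * y))) =
      (\<lambda>y. c ^ k * (indicator {0..} y *\<^sub>R ((y - 0) ^ k * f (a + c * y))))"
    using assms by (auto simp: indicator_def power_mult_distrib zero_le_mult_iff)
  finally show ?thesis
    using assms by (simp add: tail_moment_def set_lebesgue_integral_def)
qed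

lemma tail_integrable_affine:
  fixes c :: real
  assumes "c > 0"
  shows "set_integrable lborel {a..} (\<lambda>x. (x - a) ^ k * f x) \<longleftrightarrow>
    set_integrable lborel {0..} (\<lambda>y. y ^ k * f (a + c * y))"
proof -
  have "set_integrable lborel {a..} (\<lambda>x. (x - a) ^ k * f x) \<longleftrightarrow>
      integrable lborel (\<lambda>y. indicator {a..} (a + c * y) *\<^sub>R ((a + c * y - a) ^ k * f (a + c * y)))"
    unfolding set_integrable_def
    by (rule lborel_integrable_real_affine_iff[symmetric]) (use assms in simp)
  also have "(\<lambda>y. indicator {a..} (a + c * y) *\<^sub>R ((a + c * y - a) ^ k * f (a + c * y))) =
      (\<lambda>y. c ^ k * (indicator {0..} y *\<^sub>R (y ^ k * f (a + c * y))))"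
    using assms by (auto simp: indicator_def power_mult_distrib zero_le_mult_iff)
  finally show ?thesis
    using assms by (simp add: set_integrable_def)
qed

lemma exponential_tail_moments:
  fixes d :: real
  assumes "d > 0"
  shows "set_integrable lborel {a..} (\<lambda>x. (x - a) ^ k * exp (- (x - a) / d))"
    and "tail_moment a k (\<lambda>x. exp (- (x - a) / d)) = d ^ (k + 1) * fact k"
proof -
  have "has_bochner_integral lborel (\<lambda>x. indicator {0..} x *\<^sub>R (x ^ k * exp (- x))) (fact k :: real)"
  proof (rule has_bochner_integral_nn_integral)
    have "(\<integral>\<^sup>+x. ennreal (indicator {0..} x *\<^sub>R (x ^ k * exp (- x))) \<partial>lborel) =
        (\<integral>\<^sup>+x. ennreal (x ^ k * exp (- x)) * indicator {0..} x \<partial>lborel)"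
      by (intro nn_integral_cong) (auto simp: indicator_def)
    then show "(\<integral>\<^sup>+x. ennreal (indicator {0..} x *\<^sub>R (x ^ k * exp (- x))) \<partial>lborel) = ennreal (fact k)"
      by (simp add: nn_intergal_power_times_exp_Ici)
  qed (auto simp: indicator_def)
  then have *: "set_integrable lborel {0..} (\<lambda>x::real. x ^ k * exp (- x))"
  "tail_moment 0 k (\<lambda>x. exp (- x)) = fact k"
    by (auto simp: set_integrable_def tail_moment_def set_lebesgue_integral_def
        has_bochner_integral_iff)
  show "set_integrable lborel {a..} (\<lambda>x. (x - a) ^ k * exp (- (x - a) / d))"
    using *(1) assms by (subst tail_integrable_affine[OF assms]) simp
  show "tail_moment a k (\<lambda>x. exp (- (x - a) / d)) = d ^ (k + 1) * fact k"
    using *(2) assms by (subst tail_moment_affine[OF assms]) simp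
qed

text \<open>The base point \<open>b\<close> is arbitrary because a power of \<open>x - b\<close> is a linear combination of powers
  of \<open>x - \<mu>\<close>, whose integrals against the normal density are known to exist.\<close>
lemma gaussian_tail_integrable:
  assumes "\<sigma> > 0"
  shows "set_integrable lborel {a..} (\<lambda>x. (x - b) ^ k * gaussian F \<mu> \<sigma> x)"
proof -
  have g: "gaussian F \<mu> \<sigma> x = F * sqrt (2 * pi * \<sigma>\<^sup>2) * normal_density \<mu> \<sigma> x" for x
    using assms by (simp add: gaussian_def normal_density_def)
  have b: "(x - b) ^ k * gaussian F \<mu> \<sigma> x =
      (\<Sum>i\<le>k. (of_nat (k choose i) * (\<mu> - b) ^ (k - i) * F * sqrt (2 * pi * \<sigma>\<^sup>2)) *
        (normal_density \<mu> \<sigma> x * (x - \<mu>) ^ i))" for x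
    using binomial_ring[of "x - \<mu>" "\<mu> - b" k]
    by (simp add: g sum_distrib_left sum_distrib_right mult_ac)
  have "integrable lborel (\<lambda>x. (x - b) ^ k * gaussian F \<mu> \<sigma> x)"
    unfolding b
    by (intro Bochner_Integration.integrable_sum integrable_mult_right integrable_normal_moment assms)
  then show ?thesis
    unfolding set_integrable_def by (rule integrable_mult_indicator[rotated]) simp
qed

text \<open>Needed wherever the mean is used: with zero mass, the quotient defining it would
  be a division by zero.\<close>
lemma gaussian_tail_mass_pos:
  assumes "F > 0" "\<sigma> > 0"
  shows "tail_moment a 0 (gaussian F \<mu> \<sigma>) > 0"
proof -
  let ?g = "\<lambda>x. indicator {a..} x *\<^sub>R ((x - a) ^ 0 * gaussian F \<mu> \<sigma> x)"
  have nn: "0 \<le> ?g x" for x using assms by (auto simp: gaussian_def indicator_def)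
  have "integral\<^sup>L lborel ?g \<noteq> 0"
  proof
    assume "integral\<^sup>L lborel ?g = 0"
    then have "AE x in lborel. ?g x = 0"
      using integral_nonneg_eq_0_iff_AE[of lborel ?g] nn
        gaussian_tail_integrable[OF assms(2), of a a 0 F \<mu>]
      by (simp add: set_integrable_def)
    then have "AE x in lborel. x \<notin> {a..a + 1}"
      by eventually_elim (use assms in \<open>auto simp: gaussian_def\<close>)
    then have "{a..a + 1} \<in> null_sets lborel"
      by (subst AE_iff_null_sets) auto
    then show False by (simp add: null_sets_def)
  qed
  moreover have "integral\<^sup>L lborel ?g \<ge> 0" using nn by (intro integral_nonneg_AE) auto
  ultimately show ?thesis by (simp add: tail_moment_def set_lebesgue_integral_def)
qed

lemma gaussian_tail_mean_variance:
  fixes F \<mu> \<sigma> a :: real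
  defines "f \<equiv> gaussian F \<mu> \<sigma>"
  assumes "F > 0" "\<sigma> > 0"
  shows "mean_over {a..} f = a + tail_moment a 1 f / tail_moment a 0 f"
    and "variance_over {a..} f =
      tail_moment a 2 f / tail_moment a 0 f - (tail_moment a 1 f / tail_moment a 0 f)\<^sup>2"
proof -
  define J where "J k = tail_moment a k f" for k
  have J0: "J 0 > 0" unfolding J_def f_def by (rule gaussian_tail_mass_pos[OF assms(2,3)])
  have mass: "(LINT x:{a..}|lborel. f x) = J 0" by (simp add: J_def tail_moment_def)
  have i: "set_integrable lborel {a..} (\<lambda>x. (x - a) ^ k * f x)" for k
    unfolding f_def by (rule gaussian_tail_integrable[OF assms(3)])
  have i0: "set_integrable lborel {a..} f" using i[of 0] by simp
  have i1: "set_integrable lborel {a..} (\<lambda>x. (x - a) * f x)" using i[of 1] by simp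
  have "(LINT x:{a..}|lborel. x * f x) = (LINT x:{a..}|lborel. a * f x + (x - a) * f x)"
    by (simp add: algebra_simps)
  also have "\<dots> = a * J 0 + J 1"
    using i0 i1 by (subst set_integral_add) (simp_all add: J_def tail_moment_def)
  finally have m: "mean_over {a..} f = a + J 1 / J 0"
    using J0 by (simp add: mean_over_def mass field_simps)
  then show "mean_over {a..} f = a + tail_moment a 1 f / tail_moment a 0 f" by (simp add: J_def)
  define e where "e = J 1 / J 0"
  have "(LINT x:{a..}|lborel. (x - mean_over {a..} f)\<^sup>2 * f x) =
      (LINT x:{a..}|lborel. ((x - a)\<^sup>2 * f x - 2 * e * ((x - a) * f x)) + e\<^sup>2 * f x)"
    unfolding m e_def[symmetric] by (simp add: power2_eq_square algebra_simps)
  also have "\<dots> = J 2 - 2 * e * J 1 + e\<^sup>2 * J 0"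
    using i0 i1 i[of 2]
    by (subst set_integral_add set_integral_diff; simp add: J_def tail_moment_def)+
  also have "\<dots> = J 2 - e\<^sup>2 * J 0" using J0 by (simp add: e_def power2_eq_square field_simps)
  finally show "variance_over {a..} f =
      tail_moment a 2 f / tail_moment a 0 f - (tail_moment a 1 f / tail_moment a 0 f)\<^sup>2"
    using J0 unfolding J_def[symmetric] e_def[symmetric]
    by (simp add: variance_over_def mass diff_divide_distrib)
qed

section \<open>The exponential distribution bounds the variance\<close>

text \<open>The exponential density on \<^term>\<open>{a..}\<close> with mean \<open>a + d\<close> has second moment \<open>2 * d\<^sup>2\<close>
  about \<open>a\<close>. The comparison with it works because the log-ratio \<open>Q\<close> of the two
  densities is a concave quadratic, and mass and mean agree: testing \<open>f - q\<close> against \<open>Q\<close>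
  detects only the second moment.\<close>
lemma gaussian_tail_second_moment_le:
  fixes F \<mu> \<sigma> a :: real
  defines "f \<equiv> gaussian F \<mu> \<sigma>"
  assumes "F > 0" "\<sigma> > 0" "d > 0" and mean: "tail_moment a 1 f = d * tail_moment a 0 f"
  shows "tail_moment a 2 f \<le> 2 * d\<^sup>2 * tail_moment a 0 f"
proof -
  define Z where "Z = tail_moment a 0 f"
  have Z: "Z > 0" unfolding Z_def f_def by (rule gaussian_tail_mass_pos[OF assms(2,3)])
  define q where "q x = Z / d * exp (- (x - a) / d)" for x
  define g where "g k x = (x - a) ^ k * f x - Z / d * ((x - a) ^ k * exp (- (x - a) / d))" for k x
  have gi: "set_integrable lborel {a..} (g k)"
    and gv: "(LINT x:{a..}|lborel. g k x) = tail_moment a k f - Z * d ^ k * fact k" for k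
  proof -
    have 1: "set_integrable lborel {a..} (\<lambda>x. (x - a) ^ k * f x)"
      unfolding f_def by (rule gaussian_tail_integrable[OF assms(3)])
    have 2: "set_integrable lborel {a..} (\<lambda>x. Z / d * ((x - a) ^ k * exp (- (x - a) / d)))"
      by (rule set_integrable_mult_right) (rule exponential_tail_moments(1)[OF \<open>d > 0\<close>])
    show "set_integrable lborel {a..} (g k)"
      unfolding g_def by (rule set_integral_diff(1)[OF 1 2])
    have "(LINT x:{a..}|lborel. Z / d * ((x - a) ^ k * exp (- (x - a) / d))) = Z * d ^ k * fact k"
      using exponential_tail_moments(2)[OF \<open>d > 0\<close>, of a k] \<open>d > 0\<close>
      unfolding tail_moment_def by (subst set_integral_mult_right) simp
    then show "(LINT x:{a..}|lborel. g k x) = tail_moment a k f - Z * d ^ k * fact k"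
      unfolding g_def set_integral_diff(2)[OF 1 2] by (simp add: tail_moment_def)
  qed
  \<comment> \<open>The coefficients of \<open>ln f - ln q\<close> in powers of \<open>x - a\<close>.\<close>
  define A B C where "A = 1 / (2 * \<sigma>\<^sup>2)" and "B = (\<mu> - a) / \<sigma>\<^sup>2 + 1 / d"
    and "C = ln F - (\<mu> - a)\<^sup>2 / (2 * \<sigma>\<^sup>2) - ln (Z / d)"
  have A: "A > 0" using assms by (simp add: A_def)
  define Q where "Q x = B * (x - a) + C - A * (x - a)\<^sup>2" for x
  have Q: "Q x = ln (f x) - ln (q x)" for x
  proof -
    have "ln (f x) = ln F - (x - \<mu>)\<^sup>2 / (2 * \<sigma>\<^sup>2)"
      using assms by (simp add: f_def gaussian_def ln_mult)
    moreover have "ln (q x) = ln (Z / d) - (x - a) / d"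
    proof -
      have "ln (q x) = ln (Z / d) + ln (exp (- (x - a) / d))"
        unfolding q_def using Z \<open>d > 0\<close> by (intro ln_mult_pos) auto
      also have "\<dots> = ln (Z / d) - (x - a) / d"
        by (simp only: ln_exp minus_divide_left[symmetric] add_uminus_conv_diff)
      finally show ?thesis .
    qed
    moreover have "(x - \<mu>)\<^sup>2 / (2 * \<sigma>\<^sup>2) =
        (x - a)\<^sup>2 / (2 * \<sigma>\<^sup>2) - (\<mu> - a) / \<sigma>\<^sup>2 * (x - a) + (\<mu> - a)\<^sup>2 / (2 * \<sigma>\<^sup>2)"
      using \<open>\<sigma> > 0\<close> by (simp add: field_simps power2_eq_square)
    ultimately show ?thesis by (simp add: Q_def A_def B_def C_def algebra_simps)
  qed
  have pos: "0 \<le> Q x * g 0 x" for x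
  proof -
    have fq: "f x > 0" "q x > 0" using assms Z by (simp_all add: f_def gaussian_def q_def)
    have "g 0 x = f x - q x" by (simp add: g_def q_def)
    \<comment> \<open>Both factors have the sign of \<open>f x - q x\<close>.\<close>
    with fq show ?thesis
      by (cases "f x \<le> q x") (auto simp: Q zero_le_mult_iff)
  qed
  have Qg: "Q x * g 0 x = (B * g 1 x + C * g 0 x) - A * g 2 x" for x
    by (simp add: Q_def g_def algebra_simps add_divide_distrib)
  have "0 \<le> (LINT x:{a..}|lborel. Q x * g 0 x)"
    unfolding set_lebesgue_integral_def by (intro integral_nonneg_AE) (simp add: pos)
  also have "\<dots> = B * (LINT x:{a..}|lborel. g 1 x) + C * (LINT x:{a..}|lborel. g 0 x)
      - A * (LINT x:{a..}|lborel. g 2 x)"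
    unfolding Qg by (simp add: set_integral_add set_integral_diff gi)
  also have "\<dots> = - A * (tail_moment a 2 f - 2 * d\<^sup>2 * Z)"
    unfolding gv using mean by (simp add: Z_def)
  finally show ?thesis using A by (simp add: Z_def mult_le_0_iff zero_le_mult_iff)
qed

lemma gaussian_tail_variance_le:
  assumes "F > 0" "\<sigma> > 0" "a < M" "mean_over {a..} (gaussian F \<mu> \<sigma>) = M"
  shows "variance_over {a..} (gaussian F \<mu> \<sigma>) \<le> (M - a)\<^sup>2"
proof -
  let ?J = "\<lambda>k. tail_moment a k (gaussian F \<mu> \<sigma>)"
  have J0: "?J 0 > 0" by (rule gaussian_tail_mass_pos[OF assms(1,2)])
  have e: "?J 1 / ?J 0 = M - a"
    using gaussian_tail_mean_variance(1)[OF assms(1,2), of a \<mu>] assms(4) by simp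
  then have "?J 1 = (M - a) * ?J 0" using J0 by (simp add: field_simps)
  then have "?J 2 \<le> 2 * (M - a)\<^sup>2 * ?J 0"
    using assms by (intro gaussian_tail_second_moment_le) auto
  then have "?J 2 / ?J 0 \<le> 2 * (M - a)\<^sup>2" using J0 by (simp add: pos_divide_le_eq)
  then show ?thesis
    using gaussian_tail_mean_variance(2)[OF assms(1,2), of a \<mu>] e by simp
qed

section \<open>Gaussians close to the exponential distribution\<close>

text \<open>Completing the square shows that \<open>f\<close> is \<open>C * exp (- y - \<epsilon> * y\<^sup>2)\<close>. The bounds come from
  \<open>1 - \<epsilon> * y\<^sup>2 \<le> exp (- \<epsilon> * y\<^sup>2) \<le> 1\<close> and the moments \<open>k!\<close> of the exponential density.\<close>
lemma near_exponential_gaussian_moments: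
  fixes F \<epsilon> :: real
  defines "f \<equiv> gaussian F (- 1 / (2 * \<epsilon>)) (1 / sqrt (2 * \<epsilon>))"
    and "C \<equiv> F * exp (- 1 / (4 * \<epsilon>))"
  assumes "F > 0" "\<epsilon> > 0"
  shows "tail_moment 0 k f \<le> C * fact k"
    and "C * (fact k - \<epsilon> * fact (k + 2)) \<le> tail_moment 0 k f"
proof -
  have f: "f y = C * exp (- y - \<epsilon> * y\<^sup>2)" for y
  proof -
    have s: "(1 / sqrt (2 * \<epsilon>))\<^sup>2 = 1 / (2 * \<epsilon>)" using assms by (simp add: power_divide)
    have "- ((y - (- 1 / (2 * \<epsilon>)))\<^sup>2) / (2 * (1 / sqrt (2 * \<epsilon>))\<^sup>2) =
        - 1 / (4 * \<epsilon>) + (- y - \<epsilon> * y\<^sup>2)"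
      unfolding s using assms by (simp add: field_simps power2_eq_square)
    then show ?thesis unfolding f_def gaussian_def C_def by (simp only: exp_add mult.assoc)
  qed
  have C: "C > 0" using assms by (simp add: C_def)
  have ei: "set_integrable lborel {0..} (\<lambda>y::real. y ^ k * exp (- y))" for k :: nat
    using exponential_tail_moments(1)[of 1 0 k] by simp
  have ev: "(LINT y:{0..}|lborel. y ^ k * exp (- y)) = (fact k :: real)" for k :: nat
    using exponential_tail_moments(2)[of 1 0 k] by (simp add: tail_moment_def)
  have fi: "set_integrable lborel {0..} (\<lambda>y. y ^ k * f y)"
    using gaussian_tail_integrable[of "1 / sqrt (2 * \<epsilon>)" 0 0 k F] assms(3,4)
    by (simp add: f_def)
  have "(LINT y:{0..}|lborel. y ^ k * f y) \<le> (LINT y:{0..}|lborel. C * (y ^ k * exp (- y)))"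
  proof (intro set_integral_mono fi set_integrable_mult_right ei)
    fix y :: real assume "y \<in> {0..}"
    then have "y ^ k * (C * exp (- y - \<epsilon> * y\<^sup>2)) \<le> y ^ k * (C * exp (- y))"
      using C \<open>\<epsilon> > 0\<close> by (intro mult_left_mono) auto
    then show "y ^ k * f y \<le> C * (y ^ k * exp (- y))" by (simp add: f mult_ac)
  qed
  then show "tail_moment 0 k f \<le> C * fact k" by (simp add: ev tail_moment_def)
  have "(LINT y:{0..}|lborel. C * (y ^ k * exp (- y)) - C * \<epsilon> * (y ^ (k + 2) * exp (- y)))
      \<le> (LINT y:{0..}|lborel. y ^ k * f y)"
  proof (intro set_integral_mono fi)
    fix y :: real assume "y \<in> {0..}"
    then have "C * y ^ k * exp (- y) * (1 - \<epsilon> * y\<^sup>2) \<le> C * y ^ k * exp (- y) * exp (- (\<epsilon> * y\<^sup>2))"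
      using C exp_ge_add_one_self[of "- (\<epsilon> * y\<^sup>2)"] by (intro mult_left_mono) auto
    then show "C * (y ^ k * exp (- y)) - C * \<epsilon> * (y ^ (k + 2) * exp (- y)) \<le> y ^ k * f y"
      by (simp add: f exp_diff exp_minus power_add power2_eq_square divide_inverse algebra_simps)
  qed (intro set_integral_diff(1) set_integrable_mult_right ei)
  also have "(LINT y:{0..}|lborel. C * (y ^ k * exp (- y)) - C * \<epsilon> * (y ^ (k + 2) * exp (- y)))
      = C * (fact k - \<epsilon> * fact (k + 2))"
    using ei[of k] ei[of "k + 2"] ev[of k] ev[of "k + 2"]
    by (subst set_integral_diff)
      (auto simp only: set_integral_mult_right intro!: set_integrable_mult_right,
        simp add: algebra_simps)
  finally show "C * (fact k - \<epsilon> * fact (k + 2)) \<le> tail_moment 0 k f" by (simp add: tail_moment_def)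
qed

text \<open>Dilating and shifting the Gaussian of the previous lemma makes its mean equal to \<open>M\<close>, while
  leaving \<open>J 2 * J 0 / (J 1)\<^sup>2\<close> unchanged; this ratio is at least
  \<open>(2 - 24 * \<epsilon>) * (1 - 2 * \<epsilon>) \<ge> 2 - 28 * \<epsilon>\<close>. The bound on \<open>\<epsilon>\<close> keeps the lower bounds of
  all three moments positive.\<close>
lemma gaussian_tail_variance_approaches:
  assumes "F > 0" "a < M" "0 < \<epsilon>" "\<epsilon> < 1 / 24"
  obtains \<mu> \<sigma> where "\<sigma> > 0" "mean_over {a..} (gaussian F \<mu> \<sigma>) = M"
    "(M - a)\<^sup>2 * (1 - 28 * \<epsilon>) \<le> variance_over {a..} (gaussian F \<mu> \<sigma>)"
proof -
  define \<nu> \<tau> where "\<nu> = - 1 / (2 * \<epsilon>)" and "\<tau> = 1 / sqrt (2 * \<epsilon>)"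
  define J where "J k = tail_moment 0 k (gaussian F \<nu> \<tau>)" for k
  define C where "C = F * exp (- 1 / (4 * \<epsilon>))"
  have C: "C > 0" using assms by (simp add: C_def)
  note bd = near_exponential_gaussian_moments[OF assms(1,3), folded \<nu>_def \<tau>_def C_def J_def]
  have b0: "C * (1 - 2 * \<epsilon>) \<le> J 0" and b1: "C * (1 - 6 * \<epsilon>) \<le> J 1" "J 1 \<le> C"
    and b2: "C * (2 - 24 * \<epsilon>) \<le> J 2"
    using bd[of 0] bd[of 1] bd[of 2] by (simp_all add: fact_numeral mult_ac)
  have J: "J 0 > 0" "J 1 > 0"
    using b0 b1(1) C assms(4) by (auto intro: less_le_trans[rotated])
  \<comment> \<open>The unscaled mean is \<open>J 1 / J 0\<close>, and the scaled one has to lie at distance \<open>M - a\<close> from \<open>a\<close>.\<close>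
  define c where "c = (M - a) * J 0 / J 1"
  have c: "c > 0" using J assms by (simp add: c_def)
  define \<mu> \<sigma> where "\<mu> = a + c * \<nu>" and "\<sigma> = c * \<tau>"
  have "\<sigma> > 0" using c assms by (simp add: \<sigma>_def \<tau>_def)
  have scaled: "gaussian F \<mu> \<sigma> (a + c * y) = gaussian F \<nu> \<tau> y" for y
  proof -
    have "(a + c * y - \<mu>)\<^sup>2 = c\<^sup>2 * (y - \<nu>)\<^sup>2" 
      by (simp add: \<mu>_def power_mult_distrib[symmetric] algebra_simps)
    then show ?thesis using c by (simp add: gaussian_def \<sigma>_def power_mult_distrib)
  qed
  have T: "tail_moment a k (gaussian F \<mu> \<sigma>) = c ^ (k + 1) * J k" for k
    by (subst tail_moment_affine[OF c]) (simp add: J_def scaled)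
  have r: "tail_moment a 1 (gaussian F \<mu> \<sigma>) / tail_moment a 0 (gaussian F \<mu> \<sigma>) = M - a"
    unfolding T using c J by (simp add: power2_eq_square) (simp add: c_def)
  note mv = gaussian_tail_mean_variance[OF assms(1) \<open>\<sigma> > 0\<close>, of a \<mu>, unfolded r]
  have "variance_over {a..} (gaussian F \<mu> \<sigma>) = c\<^sup>2 * (J 2 / J 0) - (M - a)\<^sup>2"
    unfolding mv(2) T using c J by (simp add: power2_eq_square power3_eq_cube)
  also have "\<dots> = (M - a)\<^sup>2 * (J 2 * J 0 / (J 1)\<^sup>2 - 1)"
    using J by (simp add: c_def field_simps power2_eq_square)
  finally have v: "variance_over {a..} (gaussian F \<mu> \<sigma>) = (M - a)\<^sup>2 * (J 2 * J 0 / (J 1)\<^sup>2 - 1)" .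
  have "(2 - 28 * \<epsilon>) * (J 1)\<^sup>2 \<le> (2 - 24 * \<epsilon>) * (1 - 2 * \<epsilon>) * C\<^sup>2"
  proof (rule mult_mono)
    show "2 - 28 * \<epsilon> \<le> (2 - 24 * \<epsilon>) * (1 - 2 * \<epsilon>)" using assms by (simp add: algebra_simps)
    show "(J 1)\<^sup>2 \<le> C\<^sup>2" using b1 J by (intro power_mono) auto
    show "0 \<le> (2 - 24 * \<epsilon>) * (1 - 2 * \<epsilon>)" using assms by (intro mult_nonneg_nonneg) auto
  qed simp
  also have "\<dots> = (C * (2 - 24 * \<epsilon>)) * (C * (1 - 2 * \<epsilon>))" by (simp add: power2_eq_square)
  also have "\<dots> \<le> J 2 * J 0"
    using b0 b2 C assms J
    by (intro mult_mono) (auto intro: order_trans[OF _ b2])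
  finally have "2 - 28 * \<epsilon> \<le> J 2 * J 0 / (J 1)\<^sup>2" using J by (simp add: pos_le_divide_eq)
  then have "(M - a)\<^sup>2 * (1 - 28 * \<epsilon>) \<le> variance_over {a..} (gaussian F \<mu> \<sigma>)"
    unfolding v by (intro mult_left_mono) auto
  then show ?thesis using that[OF \<open>\<sigma> > 0\<close>] mv(1) by simp
qed

section \<open>The suprema\<close>

lemma SUP_variance_right_tail:
  assumes "F > 0" "a < M"
  shows "(SUP (\<mu>, \<sigma>) \<in> {(\<mu>, \<sigma>). \<sigma> > 0 \<and> mean_over {a..} (gaussian F \<mu> \<sigma>) = M}.
    ereal (variance_over {a..} (gaussian F \<mu> \<sigma>))) = ereal ((M - a)\<^sup>2)"
proof (rule SUP_eqI)
  fix y :: ereal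
  assume *: "\<And>p. p \<in> {(\<mu>, \<sigma>). \<sigma> > 0 \<and> mean_over {a..} (gaussian F \<mu> \<sigma>) = M} \<Longrightarrow>
    (case p of (\<mu>, \<sigma>) \<Rightarrow> ereal (variance_over {a..} (gaussian F \<mu> \<sigma>))) \<le> y"
  have "((\<lambda>\<epsilon>. (M - a)\<^sup>2 * (1 - 28 * \<epsilon>)) \<longlongrightarrow> (M - a)\<^sup>2 * (1 - 28 * 0)) (at_right 0)"
    by (intro tendsto_intros)
  then have "((\<lambda>\<epsilon>. ereal ((M - a)\<^sup>2 * (1 - 28 * \<epsilon>))) \<longlongrightarrow> ereal ((M - a)\<^sup>2)) (at_right 0)"
    by simp
  moreover have "eventually (\<lambda>\<epsilon>. ereal ((M - a)\<^sup>2 * (1 - 28 * \<epsilon>)) \<le> y) (at_right 0)"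
  proof (rule eventually_at_rightI)
    fix \<epsilon> :: real assume "\<epsilon> \<in> {0<..<1 / 24}"
    then have "0 < \<epsilon>" "\<epsilon> < 1 / 24" by auto
    then obtain \<mu> \<sigma> where "\<sigma> > 0" "mean_over {a..} (gaussian F \<mu> \<sigma>) = M"
      and le: "(M - a)\<^sup>2 * (1 - 28 * \<epsilon>) \<le> variance_over {a..} (gaussian F \<mu> \<sigma>)"
      using gaussian_tail_variance_approaches[OF assms] by blast
    then have "ereal (variance_over {a..} (gaussian F \<mu> \<sigma>)) \<le> y" using *[of "(\<mu>, \<sigma>)"] by simp
    with le show "ereal ((M - a)\<^sup>2 * (1 - 28 * \<epsilon>)) \<le> y" by (meson ereal_less_eq(3) order_trans)
  qed simp
  ultimately show "ereal ((M - a)\<^sup>2) \<le> y"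
    by (rule tendsto_upperbound) simp
qed (use assms gaussian_tail_variance_le in auto)

lemma gaussian_reflect:
  "mean_over {..a} (gaussian F \<mu> \<sigma>) = - mean_over {- a..} (gaussian F (- \<mu>) \<sigma>)"
  "variance_over {..a} (gaussian F \<mu> \<sigma>) = variance_over {- a..} (gaussian F (- \<mu>) \<sigma>)"
proof -
  have r: "(LINT x:{..a}|lborel. h x) = (LINT x:{- a..}|lborel. h (- x))" for h :: "real \<Rightarrow> real"
  proof -
    have "indicator {..a} (- x) = (indicator {- a..} x :: real)" for x
      by (auto simp: indicator_def)
    then show ?thesis
      unfolding set_lebesgue_integral_def
      using lborel_integral_real_affine[of "-1" "\<lambda>x. indicator {..a} x *\<^sub>R h x" 0] by simp
  qed
  have g: "gaussian F \<mu> \<sigma> (- x) = gaussian F (- \<mu>) \<sigma> x" for x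
  proof -
    have "(- x - \<mu>)\<^sup>2 = (x - - \<mu>)\<^sup>2" by (simp add: power2_eq_square algebra_simps)
    then show ?thesis unfolding gaussian_def by (rule arg_cong)
  qed
  show m: "mean_over {..a} (gaussian F \<mu> \<sigma>) = - mean_over {- a..} (gaussian F (- \<mu>) \<sigma>)"
    unfolding mean_over_def r g by (simp add: set_lebesgue_integral_def)
  have s: "(- x - - u)\<^sup>2 = (x - u)\<^sup>2" for x u :: real
    by (simp add: power2_commute)
  show "variance_over {..a} (gaussian F \<mu> \<sigma>) = variance_over {- a..} (gaussian F (- \<mu>) \<sigma>)"
    unfolding variance_over_def m r g s ..
qed

lemma SUP_variance_left_tail:
  assumes "F > 0" "a > M"
  shows "(SUP (\<mu>, \<sigma>) \<in> {(\<mu>, \<sigma>). \<sigma> > 0 \<and> mean_over {..a} (gaussian F \<mu> \<sigma>) = M}.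
    ereal (variance_over {..a} (gaussian F \<mu> \<sigma>))) = ereal ((M - a)\<^sup>2)"
proof -
  let ?R = "{(\<mu>, \<sigma>). \<sigma> > 0 \<and> mean_over {- a..} (gaussian F \<mu> \<sigma>) = - M}"
  have "{(\<mu>, \<sigma>). \<sigma> > 0 \<and> mean_over {..a} (gaussian F \<mu> \<sigma>) = M} = map_prod uminus id ` ?R"
  proof (intro equalityI subsetI)
    fix p assume "p \<in> {(\<mu>, \<sigma>). \<sigma> > 0 \<and> mean_over {..a} (gaussian F \<mu> \<sigma>) = M}"
    then show "p \<in> map_prod uminus id ` ?R"
      by (intro image_eqI[of _ _ "map_prod uminus id p"]) (auto simp: gaussian_reflect)
  qed (auto simp: gaussian_reflect)
  then have "(SUP (\<mu>, \<sigma>) \<in> {(\<mu>, \<sigma>). \<sigma> > 0 \<and> mean_over {..a} (gaussian F \<mu> \<sigma>) = M}.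
      ereal (variance_over {..a} (gaussian F \<mu> \<sigma>))) =
    (SUP (\<mu>, \<sigma>) \<in> ?R. ereal (variance_over {- a..} (gaussian F \<mu> \<sigma>)))"
    by (simp add: image_image case_prod_beta gaussian_reflect)
  also have "\<dots> = ereal ((- M - - a)\<^sup>2)"
    using assms by (intro SUP_variance_right_tail) auto
  finally show ?thesis by (simp add: power2_commute)
qed

theorem mainTheorem2:
  fixes a M fmax :: real
  assumes "fmax > 0"
  shows "(a < M \<longrightarrow>
           (SUP (\<mu>, \<sigma>) \<in> {(\<mu>, \<sigma>). \<sigma> > 0 \<and> mean_over {a..} (gaussian fmax \<mu> \<sigma>) = M}.
              ereal (variance_over {a..} (gaussian fmax \<mu> \<sigma>))) = ereal ((M - a)\<^sup>2))
       \<and> (a > M \<longrightarrow>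
           (SUP (\<mu>, \<sigma>) \<in> {(\<mu>, \<sigma>). \<sigma> > 0 \<and> mean_over {..a} (gaussian fmax \<mu> \<sigma>) = M}.
              ereal (variance_over {..a} (gaussian fmax \<mu> \<sigma>))) = ereal ((M - a)\<^sup>2))"
  using assms SUP_variance_right_tail SUP_variance_left_tail by blast

end
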